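(* Every $\Delta(1,2,2)$-free tournament $T$ with $n$ vertices satisfies $\vec{\alpha}(T)\ge \frac{3n}{7}$.
   Context: Tournaments are finite; $T$ is $S$-free if no induced subtournament of $T$ is isomorphic to $S$. $\Delta(1,2,2)$ is the tournament on $\{x,y_1,y_2,z_1,z_2\}$ in which every edge between $x$ and $\{y_1,y_2\}$ goes from $x$, every edge between $\{y_1,y_2\}$ and $\{z_1,z_2\}$ goes into $\{z_1,z_2\}$, every edge between $\{z_1,z_2\}$ and $x$ goes into $x$, and $y_1y_2$, $z_1z_2$ are edges. $\vec{\alpha}(T)$ denotes the maximum number of vertices of a transitive subtournament of $T$. *)

theory Defs
  imports Complex_Main "Graph_Theory.Digraph_Isomorphism"
begin

text \<open>
  The locale \<^locale>\<open>digraph\<close> already makes a tournament finite, loopless and without parallel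
  arcs; the null digraph is allowed.
\<close>

locale tournament = digraph +
  assumes one_direction:
    "u \<in> verts G \<Longrightarrow> v \<in> verts G \<Longrightarrow> u \<noteq> v \<Longrightarrow> (u \<rightarrow>\<^bsub>G\<^esub> v) \<longleftrightarrow> \<not> (v \<rightarrow>\<^bsub>G\<^esub> u)"

definition transitive_tournament :: "('a, 'b) pre_digraph \<Rightarrow> bool" where
  "transitive_tournament G \<longleftrightarrow> tournament G \<and> trans (arcs_ends G)"

definition free_of :: "('c, 'd) pre_digraph \<Rightarrow> ('a, 'b) pre_digraph \<Rightarrow> bool" where
  "free_of S T \<longleftrightarrow> \<not> (\<exists>H. induced_subgraph H T \<and> digraph_iso H S)"

definition trans_number :: "('a, 'b) pre_digraph \<Rightarrow> nat" where
  "trans_number T = Max {card (verts H) | H. subgraph H T \<and> transitive_tournament H}"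

datatype delta_vertex = X | Y1 | Y2 | Z1 | Z2

definition Delta122 :: "(delta_vertex, delta_vertex \<times> delta_vertex) pre_digraph" where
  "Delta122 = \<lparr>
     verts = {X, Y1, Y2, Z1, Z2},
     arcs = {X} \<times> {Y1, Y2} \<union> {Y1, Y2} \<times> {Z1, Z2} \<union> {Z1, Z2} \<times> {X} \<union> {(Y1, Y2), (Z1, Z2)},
     tail = fst,
     head = snd\<rparr>"

lemma tournament_Delta122: "tournament Delta122"
  by unfold_locales (auto simp: Delta122_def arcs_ends_def arc_to_ends_def)

text \<open>The maximum in \<^const>\<open>trans_number\<close> is attained, as its set is finite and nonempty.\<close>

lemma trans_number_attained:
  assumes "tournament T"
  shows "\<exists>H. subgraph H T \<and> transitive_tournament H \<and> card (verts H) = trans_number T"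
    and "subgraph H T \<Longrightarrow> transitive_tournament H \<Longrightarrow> card (verts H) \<le> trans_number T"
proof -
  interpret tournament T by (rule assms)
  let ?S = "{card (verts H) | H. subgraph H T \<and> transitive_tournament H}"
  have "?S \<subseteq> {..card (verts T)}"
    by (auto intro!: card_mono simp: subgraph_def)
  then have fin: "finite ?S"
    by (rule finite_subset) simp
  let ?N = "T\<lparr>verts := {}, arcs := {}\<rparr>"
  have "wf_digraph ?N"
    by unfold_locales auto
  then have "subgraph ?N T"
    using wf_digraph_axioms by (auto simp: subgraph_def compatible_def)
  moreover have "transitive_tournament ?N"
    unfolding transitive_tournament_def
    by (intro conjI, unfold_locales) (auto simp: arcs_ends_def trans_def)
  ultimately have "?S \<noteq> {}"
    by blast
  with fin have "trans_number T \<in> ?S"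
    unfolding trans_number_def by (rule Max_in)
  then show "\<exists>H. subgraph H T \<and> transitive_tournament H \<and> card (verts H) = trans_number T"
    by auto
  show "card (verts H) \<le> trans_number T" if "subgraph H T" "transitive_tournament H"
    unfolding trans_number_def by (rule Max_ge[OF fin]) (use that in blast)
qed

end

theory Submission
  imports Defs
begin

text \<open>
  Being $\Delta(1,2,2)$-free means that, for every vertex $x$, the arcs from $N^+(x)$ to $N^-(x)$ form
  a bipartite graph without 4-cycles. We induct on the number of vertices. A vertex $v$ with at most
  one in-neighbour $u$ is harmless: delete both and put $v$ in front of the solution. If all
  in-degrees are at least two, consider a vertex of minimum in-degree. Either some set \<open>C\<close> of at most
  seven vertices (the regular tournament on five vertices or the Paley tournament on seven) dominates
  everything else, and three of its vertices can be put in front of the solution; or there are two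
  cyclic triangles $A = \{a_1, a_2, a_3\}$ and $B = \{b_1, b_2, b_3\}$ such that $A$ dominates the
  rest except for the three arcs $b_i \to a_i$, and the vertices of $B$ have the same neighbours
  outside of $A \cup B$. In the last case $B$ is replaced by a single vertex, which the solution is
  required to contain; such vertices are called pins. A pin all of whose cyclic triangles share a
  second vertex is removed together with that vertex.
\<close>

subsection \<open>Vertices of minimum in-degree\<close>

locale delta122_free =
  fixes U :: "'a set" and E :: "'a \<Rightarrow> 'a \<Rightarrow> bool" (infix \<open>\<leadsto>\<close> 50)
  assumes finite_U: "finite U"
    and asym: "x \<leadsto> y \<Longrightarrow> \<not> y \<leadsto> x"
    and total: "x \<in> U \<Longrightarrow> y \<in> U \<Longrightarrow> x \<noteq> y \<Longrightarrow> x \<leadsto> y \<or> y \<leadsto> x"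
    and no_delta: "\<lbrakk>x \<in> U; y \<in> U; y' \<in> U; z \<in> U; z' \<in> U; x \<leadsto> y; x \<leadsto> y'; y \<noteq> y';
      y \<leadsto> z; y \<leadsto> z'; y' \<leadsto> z; y' \<leadsto> z'; z \<noteq> z'; z \<leadsto> x; z' \<leadsto> x\<rbrakk> \<Longrightarrow> False"
begin

text \<open>A tournament is transitive exactly when it has no cyclic triangle; in this form, only
  triangles through an added vertex need checking.\<close>

definition acyclic_on :: "'a set \<Rightarrow> bool" where
  "acyclic_on W \<longleftrightarrow> (\<forall>x\<in>W. \<forall>y\<in>W. \<forall>z\<in>W. \<not> (x \<leadsto> y \<and> y \<leadsto> z \<and> z \<leadsto> x))"

definition nbrs_in :: "'a set \<Rightarrow> 'a \<Rightarrow> 'a set" where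
  "nbrs_in V v = {u \<in> V. u \<leadsto> v}"

text \<open>
  The conditions in \<open>pins\<close> say that replacing every pin by a $\Delta(1,2,2)$-free tournament creates
  no $\Delta(1,2,2)$.
\<close>

definition pin :: "'a set \<Rightarrow> 'a \<Rightarrow> bool" where
  "pin V b \<longleftrightarrow>
     (\<forall>y\<in>V. \<forall>z\<in>V. \<forall>z'\<in>V. b \<leadsto> y \<and> y \<leadsto> z \<and> y \<leadsto> z' \<and> z \<leadsto> b \<and> z' \<leadsto> b \<longrightarrow> z = z') \<and>
     (\<forall>y\<in>V. \<forall>y'\<in>V. \<forall>z\<in>V. b \<leadsto> y \<and> b \<leadsto> y' \<and> y \<leadsto> z \<and> y' \<leadsto> z \<and> z \<leadsto> b \<longrightarrow> y = y')"

definition pins :: "'a set \<Rightarrow> 'a set \<Rightarrow> bool" where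
  "pins V K \<longleftrightarrow> K \<subseteq> V \<and> (\<forall>b\<in>K. pin V b) \<and>
     (\<forall>b\<in>K. \<forall>c\<in>K. \<forall>x\<in>V. \<not> (b \<leadsto> c \<and> c \<leadsto> x \<and> x \<leadsto> b))"

section \<open>Basic facts on pins and acyclic sets\<close>

lemma nloop: "\<not> x \<leadsto> x"
  using asym by blast

lemma arc_neq: "x \<leadsto> y \<Longrightarrow> x \<noteq> y"
  using nloop by blast

lemma pin_mono: "pin V b \<Longrightarrow> V' \<subseteq> V \<Longrightarrow> pin V' b"
  unfolding pin_def subset_iff by meson

lemma pins_mono: "pins V K \<Longrightarrow> V' \<subseteq> V \<Longrightarrow> K' \<subseteq> K \<Longrightarrow> K' \<subseteq> V' \<Longrightarrow> pins V' K'"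
  unfolding pins_def using pin_mono by (meson subsetD)

lemma pinD1: "pin V b \<Longrightarrow> {y, z, z'} \<subseteq> V \<Longrightarrow> b \<leadsto> y \<Longrightarrow> y \<leadsto> z \<Longrightarrow> y \<leadsto> z' \<Longrightarrow> z \<leadsto> b \<Longrightarrow> z' \<leadsto> b \<Longrightarrow> z = z'"
  unfolding pin_def by blast

text \<open>A pin is a vertex each of whose arcs, in or out, lies in at most one cyclic triangle.
  Two triangles on one outgoing arc refute this.\<close>

lemma not_pinI:
  "{y, z, z'} \<subseteq> V \<Longrightarrow> c \<leadsto> y \<Longrightarrow> y \<leadsto> z \<Longrightarrow> y \<leadsto> z' \<Longrightarrow> z \<leadsto> c \<Longrightarrow> z' \<leadsto> c \<Longrightarrow> z \<noteq> z' \<Longrightarrow> \<not> pin V c"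
  unfolding pin_def by blast

lemma pinD2: "pin V b \<Longrightarrow> {y, y', z} \<subseteq> V \<Longrightarrow> b \<leadsto> y \<Longrightarrow> b \<leadsto> y' \<Longrightarrow> y \<leadsto> z \<Longrightarrow> y' \<leadsto> z \<Longrightarrow> z \<leadsto> b \<Longrightarrow> y = y'"
  unfolding pin_def by blast

lemma acyclic_on_insert:
  assumes "acyclic_on W" "\<And>y z. y \<in> W \<Longrightarrow> z \<in> W \<Longrightarrow> \<not> (b \<leadsto> y \<and> y \<leadsto> z \<and> z \<leadsto> b)"
  shows "acyclic_on (insert b W)"
  using assms nloop unfolding acyclic_on_def by blast

lemma acyclic_on_insert_source:
  assumes "acyclic_on W" "\<And>w. w \<in> W \<Longrightarrow> b \<leadsto> w"
  shows "acyclic_on (insert b W)"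
  using assms asym by (intro acyclic_on_insert) blast+

section \<open>In-neighbourhoods of the tails of arcs inside an in-neighbourhood\<close>

lemma doubletonI: "A = {x, y} \<Longrightarrow> a \<in> A \<Longrightarrow> b \<in> A \<Longrightarrow> a \<noteq> b \<Longrightarrow> A = {a, b}"
  by blast

text \<open>If distinct \<open>s, s'\<close> both enter \<open>q\<close>, then \<open>v\<close> ->
  \<open>{s, s'}\<close> -> \<open>{p, q}\<close> -> \<open>v\<close> is forbidden; if both leave
  \<open>q\<close>, then \<open>p\<close> -> \<open>{v, q}\<close> -> \<open>{s, s'}\<close> ->
  \<open>p\<close> is. So \<open>p\<close> has at most two in-neighbours outside those of
  \<open>v\<close>.\<close>

lemma nbrs_in_outside:
  assumes V: "V \<subseteq> U" and v: "v \<in> V" and pq: "p \<in> nbrs_in V v" "q \<in> nbrs_in V v" "p \<leadsto> q"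
    and s: "s \<in> nbrs_in V p - nbrs_in V v"
  shows "v \<leadsto> s" "s \<leadsto> q \<or> q \<leadsto> s"
    and "s' \<in> nbrs_in V p - nbrs_in V v \<Longrightarrow> s \<leadsto> q \<Longrightarrow> s' \<leadsto> q \<Longrightarrow> s = s'"
    and "s' \<in> nbrs_in V p - nbrs_in V v \<Longrightarrow> q \<leadsto> s \<Longrightarrow> q \<leadsto> s' \<Longrightarrow> s = s'"
proof -
  have pv: "p \<in> V" "q \<in> V" "p \<leadsto> v" "q \<leadsto> v"
    using pq unfolding nbrs_in_def by auto
  have out: "v \<leadsto> x" "x \<leadsto> q \<or> q \<leadsto> x" if "x \<in> nbrs_in V p - nbrs_in V v" for x
    using that pq pv V v total[of x v] total[of x q] asym[of p v] by (auto simp: nbrs_in_def)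
  then show "v \<leadsto> s" "s \<leadsto> q \<or> q \<leadsto> s"
    using s by blast+
  show "s = s'" if "s' \<in> nbrs_in V p - nbrs_in V v" "s \<leadsto> q" "s' \<leadsto> q"
    using no_delta[of v s s' p q] that s out(1)[OF s] out(1)[OF that(1)] V v pv arc_neq[OF pq(3)]
    by (auto simp: nbrs_in_def)
  show "s = s'" if "s' \<in> nbrs_in V p - nbrs_in V v" "q \<leadsto> s" "q \<leadsto> s'"
    using no_delta[of p v q s s'] that s out(1)[OF s] out(1)[OF that(1)] V v pv arc_neq[OF pv(4)] pq
    by (auto simp: nbrs_in_def)
qed

text \<open>No in-neighbour of \<open>p\<close> is \<open>p\<close> or \<open>q\<close>, so all lie
  outside \<open>nbrs_in V v\<close>. There are at most two, one entering \<open>q\<close> and one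
  leaving it, and the degree bound forces both to exist.\<close>

lemma nbrs_in_pair:
  assumes V: "V \<subseteq> U" and v: "v \<in> V" and N: "nbrs_in V v = {p, q}" and pq: "p \<leadsto> q"
    and deg: "2 \<le> card (nbrs_in V p)"
  obtains s t where "nbrs_in V p = {s, t}" "s \<leadsto> q" "q \<leadsto> t" "v \<leadsto> s" "v \<leadsto> t"
proof -
  have pN: "p \<in> nbrs_in V v" "q \<in> nbrs_in V v"
    using N by auto
  have out: "s \<in> nbrs_in V p - nbrs_in V v" if "s \<in> nbrs_in V p" for s
    using that pq asym[of p q] nloop unfolding N by (auto simp: nbrs_in_def)
  note o = nbrs_in_outside[OF V v pN pq out]
  obtain s t where "s \<in> nbrs_in V p" "t \<in> nbrs_in V p" "s \<noteq> t"
    using deg by (metis card_le_Suc0_iff_eq card.infinite not_less_eq_eq numeral_2_eq_2 zero_le)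
  then have "\<exists>s t. s \<in> nbrs_in V p \<and> t \<in> nbrs_in V p \<and> s \<leadsto> q \<and> q \<leadsto> t"
    using o(2)[of s] o(2)[of t] o(3)[of s t] o(4)[of s t] out[of t] by blast
  then obtain s t where st: "s \<in> nbrs_in V p" "t \<in> nbrs_in V p" "s \<leadsto> q" "q \<leadsto> t"
    by blast
  have "x = s \<or> x = t" if "x \<in> nbrs_in V p" for x
    using o(2-4)[OF that] out[OF st(1)] out[OF st(2)] st by blast
  then have "nbrs_in V p = {s, t}"
    using st by blast
  then show thesis
    using that[OF _ st(3,4)] o(1)[OF st(1)] o(1)[OF st(2)] by blast
qed

text \<open>Prescribing whole in-neighbourhoods encodes both the triangle \<open>a1, a2, a3\<close>
  and its domination of the rest. The behaviour of the \<open>b\<close>s is derived later from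
  \<open>no_delta\<close>.\<close>

definition triple_arc :: "'a set \<Rightarrow> 'a \<Rightarrow> 'a \<Rightarrow> 'a \<Rightarrow> 'a \<Rightarrow> 'a \<Rightarrow> 'a \<Rightarrow> bool" where
  "triple_arc V a1 a2 a3 b1 b2 b3 \<longleftrightarrow> {a1, a2, a3, b1, b2, b3} \<subseteq> V \<and>
     nbrs_in V a1 = {a3, b1} \<and> nbrs_in V a2 = {a1, b2} \<and> nbrs_in V a3 = {a2, b3} \<and>
     distinct [a1, a2, a3, b1, b2, b3]"

text \<open>A transitive triple out of at most seven vertices meets the ratio $3/7$. Excluding pins
  from \<open>C\<close> ensures that deleting it loses none of them.\<close>

definition initial_core :: "'a set \<Rightarrow> 'a set \<Rightarrow> bool" where
  "initial_core V C \<longleftrightarrow> C \<subseteq> V \<and> card C \<le> 7 \<and> (\<forall>c\<in>C. \<forall>u\<in>V - C. c \<leadsto> u) \<and> (\<forall>c\<in>C. \<not> pin V c) \<and>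
     (\<exists>p\<in>C. \<exists>q\<in>C. \<exists>v\<in>C. p \<leadsto> q \<and> p \<leadsto> v \<and> q \<leadsto> v)"

lemma initial_coreI:
  assumes V: "V \<subseteq> U" and C: "C \<subseteq> V" "card C \<le> 7"
    and closed: "\<And>c. c \<in> C \<Longrightarrow> nbrs_in V c \<subseteq> C"
    and np: "\<And>c. c \<in> C \<Longrightarrow> \<not> pin V c"
    and R: "{p, q, v} \<subseteq> C" "p \<leadsto> q" "p \<leadsto> v" "q \<leadsto> v"
  shows "initial_core V C"
proof -
  have "c \<leadsto> u" if "c \<in> C" "u \<in> V - C" for c u
    using closed[OF that(1)] that C V total[of c u] by (auto simp: nbrs_in_def)
  then show ?thesis
    unfolding initial_core_def using C np R
    by (intro conjI ballI bexI[of _ p] bexI[of _ q] bexI[of _ v]) auto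
qed

lemma exists_triple_arc_or_initial_core_two:
  assumes V: "V \<subseteq> U" and v: "v \<in> V" and deg: "\<And>x. x \<in> V \<Longrightarrow> 2 \<le> card (nbrs_in V x)"
    and two: "card (nbrs_in V v) = 2"
  shows "(\<exists>a1 a2 a3 b1 b2 b3. triple_arc V a1 a2 a3 b1 b2 b3) \<or> (\<exists>C. initial_core V C)"
proof -
  have inV: "x \<in> V" "x \<leadsto> y" if "nbrs_in V y = S" "x \<in> S" for x y S
    using that by (auto simp: nbrs_in_def)
  obtain p0 q0 where pq0: "nbrs_in V v = {p0, q0}" "p0 \<noteq> q0"
    using two by (auto simp: card_2_iff)
  then have "p0 \<leadsto> q0 \<or> q0 \<leadsto> p0"
    using inV[OF pq0(1)] V total[of p0 q0] by auto
  then obtain p q where N: "nbrs_in V v = {p, q}" and pq: "p \<leadsto> q"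
    using pq0(1) by (metis insert_commute)
  have p: "p \<in> V" "q \<in> V" "p \<leadsto> v" "q \<leadsto> v"
    using inV[OF N] by auto
  obtain s t where P: "nbrs_in V p = {s, t}" and st: "s \<leadsto> q" "q \<leadsto> t" "v \<leadsto> s" "v \<leadsto> t"
    using nbrs_in_pair[OF V v N pq deg] p by blast
  have s: "s \<in> V" "t \<in> V" "s \<leadsto> p" "t \<leadsto> p"
    using inV[OF P] by auto
  have "s \<noteq> t"
    using st asym by blast
  then consider "s \<leadsto> t" | "t \<leadsto> s"
    using V s total[of s t] by auto
  then show ?thesis
  proof cases
    case 1
    obtain s' t' where S: "nbrs_in V s = {s', t'}" and st': "s' \<leadsto> t" "t \<leadsto> t'"
      using nbrs_in_pair[OF V p(1) P 1 deg] s by blast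
    have t': "t' \<in> V" "t' \<leadsto> s" "s' \<leadsto> s"
      using inV[OF S] by auto
    \<comment> \<open>\<open>v\<close> is an in-neighbour of \<open>s\<close> dominating
      \<open>t\<close>, so it is \<open>s'\<close>. The triple arc then has triangle
      \<open>v, s, p\<close> and attached vertices \<open>q, t', t\<close>.\<close>
    have "v \<in> nbrs_in V s"
      using v st by (auto simp: nbrs_in_def)
    then have "v = s'"
      using S st'(2) asym[OF st(4)] by auto
    have "v \<noteq> t'" "p \<noteq> t'" "q \<noteq> t'"
      using asym[OF st'(2)] asym[OF t'(2)] st s by auto
    moreover have "v \<noteq> s" "v \<noteq> p" "v \<noteq> q" "v \<noteq> t" "s \<noteq> p" "s \<noteq> q" "s \<noteq> t" "s \<noteq> t'"
      "p \<noteq> q" "p \<noteq> t" "q \<noteq> t" "t \<noteq> t'"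
      using st st' p s t' 1 pq nloop by auto
    ultimately have "triple_arc V v s p q t' t"
      using N P S v p s t' \<open>v = s'\<close> unfolding triple_arc_def by auto
    then show ?thesis
      by blast
  next
    case 2
    \<comment> \<open>The arc inside each newly found pair is known, so \<open>nbrs_in_pair\<close>
      applies in turn to \<open>p\<close>, \<open>t\<close> and \<open>q\<close>. The
      in-neighbourhoods close up on five vertices, each of in-degree two.\<close>
    have P': "nbrs_in V p = {t, s}"
      using P by blast
    obtain x y where "nbrs_in V t = {x, y}"
      using nbrs_in_pair[OF V p(1) P' 2 deg] s by metis
    moreover have "q \<noteq> v" "q \<in> nbrs_in V t" "v \<in> nbrs_in V t"
      using v st s p pq 2 nloop by (auto simp: nbrs_in_def)
    ultimately have Tn: "nbrs_in V t = {q, v}"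
      by (metis doubletonI)
    obtain x y where "nbrs_in V q = {x, y}"
      using nbrs_in_pair[OF V s(2) Tn p(4) deg] p by metis
    moreover have "s \<noteq> p" "s \<in> nbrs_in V q" "p \<in> nbrs_in V q"
      using v st s p pq 2 nloop by (auto simp: nbrs_in_def)
    ultimately have Q: "nbrs_in V q = {s, p}"
      by (metis doubletonI)
    obtain x y where "nbrs_in V s = {x, y}"
      using nbrs_in_pair[OF V p(2) Q s(3) deg] s by metis
    moreover have "v \<noteq> t" "v \<in> nbrs_in V s" "t \<in> nbrs_in V s"
      using v st s p pq 2 nloop by (auto simp: nbrs_in_def)
    ultimately have S: "nbrs_in V s = {v, t}"
      by (metis doubletonI)
    have "card {v, p, q, s, t} \<le> 7"
      using card_length[of "[v, p, q, s, t]"] by simp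
    moreover have "\<not> pin V v"
      by (rule not_pinI[of s p q]) (use v p s st pq nloop in auto)
    moreover have "\<not> pin V p"
      by (rule not_pinI[of v s t]) (use v p s st \<open>s \<noteq> t\<close> in auto)
    moreover have "\<not> pin V t"
      by (rule not_pinI[of p v q]) (use v p s st \<open>q \<noteq> v\<close> pq in auto)
    moreover have "\<not> pin V q"
      by (rule not_pinI[of t p s]) (use v p s st \<open>s \<noteq> p\<close> pq 2 in auto)
    moreover have "\<not> pin V s"
      by (rule not_pinI[of q v t]) (use v p s st \<open>v \<noteq> t\<close> 2 in auto)
    ultimately have "initial_core V {v, p, q, s, t}"
      using N P Q S Tn v p s pq by (intro initial_coreI[OF V, of _ p q v]) auto
    then show ?thesis
      by blast
  qed
qed

text \<open>
  For an arc $p \to q$ inside $N^-(v)$, at most two in-neighbours of $p$ lie outside $N^-(v)$. If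
  $N^-(v)$ has minimum size, it therefore has out-degree at most one everywhere, so it is a cyclic
  triangle.
\<close>

lemma min_nbrs_in:
  assumes V: "V \<subseteq> U" and v: "v \<in> V" and three: "3 \<le> card (nbrs_in V v)"
    and deg: "\<And>x. x \<in> V \<Longrightarrow> card (nbrs_in V v) \<le> card (nbrs_in V x)"
    and p: "p \<in> nbrs_in V v"
  obtains q r where "nbrs_in V v = {p, q, r}" "p \<leadsto> q" "q \<leadsto> r" "r \<leadsto> p"
    "card (nbrs_in V p) = 3" "card (nbrs_in V q) = 3" "card (nbrs_in V r) = 3" "card (nbrs_in V v) = 3"
proof -
  let ?N = "nbrs_in V v"
  have fin: "finite (nbrs_in V x)" for x
    using finite_subset[OF V finite_U] by (simp add: nbrs_in_def)
  have NV: "?N \<subseteq> V"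
    by (auto simp: nbrs_in_def)
  have outside: "card (nbrs_in V x - ?N) \<le> 2" if "x \<in> ?N" "y \<in> ?N" "x \<leadsto> y" for x y
  proof -
    note o = nbrs_in_outside[OF V v that]
    let ?A = "{s \<in> nbrs_in V x - ?N. s \<leadsto> y}" and ?B = "{s \<in> nbrs_in V x - ?N. y \<leadsto> s}"
    have "card ?A \<le> Suc 0" "card ?B \<le> Suc 0"
      using o(3,4) by (subst card_le_Suc0_iff_eq; use fin in auto)+
    moreover have "card (nbrs_in V x - ?N) = card (?A \<union> ?B)"
      using o(2) by (intro arg_cong[of _ _ card]) blast
    ultimately show ?thesis
      using card_Un_le[of ?A ?B] by linarith
  qed
  have split: "card (nbrs_in V x) \<le> card (?N - D) + card (nbrs_in V x - ?N)"
    if "D \<inter> nbrs_in V x = {}" for x D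
  proof -
    have "nbrs_in V x \<subseteq> (?N - D) \<union> (nbrs_in V x - ?N)"
      using that by blast
    then have "card (nbrs_in V x) \<le> card ((?N - D) \<union> (nbrs_in V x - ?N))"
      by (rule card_mono[rotated]) (use fin in auto)
    then show ?thesis
      using card_Un_le le_trans by blast
  qed
  \<comment> \<open>With two out-neighbours in \<open>?N\<close>, \<open>x\<close> would have at
    most \<open>card ?N - 3\<close> in-neighbours inside and two outside, fewer than the
    minimum.\<close>
  have uniq: "y = z" if "x \<in> ?N" "y \<in> ?N" "z \<in> ?N" "x \<leadsto> y" "x \<leadsto> z" for x y z
  proof (rule ccontr)
    assume "y \<noteq> z"
    then have c3: "card {x, y, z} = 3"
      using arc_neq[OF that(4)] arc_neq[OF that(5)] by simp
    have "{x, y, z} \<inter> nbrs_in V x = {}"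
      using that asym nloop by (auto simp: nbrs_in_def)
    then have "card (nbrs_in V x) \<le> card (?N - {x, y, z}) + 2"
      using split outside[OF that(1,2,4)] by (meson add_left_mono le_trans)
    moreover have "card (?N - {x, y, z}) = card ?N - 3"
      using that c3 by (subst card_Diff_subset) auto
    ultimately show False
      using three deg[of x] that(1) NV by auto
  qed
  have tot: "x \<leadsto> y \<or> y \<leadsto> x" if "x \<in> ?N" "y \<in> ?N" "x \<noteq> y" for x y
    using that NV V total by blast
  have three3: "card ?N \<le> 3" if "?N = {a, b, c}" for a b c
    using that card_length[of "[a, b, c]"] by simp
  have "\<not> ?N \<subseteq> {p, a}" for a
    using three card_mono[of "{p, a}" ?N] card_length[of "[p, a]"] by auto
  then obtain a b where "a \<in> ?N" "b \<in> ?N" "a \<noteq> p" "b \<noteq> p" "a \<noteq> b"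
    by blast
  then obtain q r where qr: "q \<in> ?N" "r \<in> ?N" and arcs: "p \<leadsto> q" "q \<leadsto> r" "r \<leadsto> p"
    using tot uniq p by metis
  \<comment> \<open>Any further \<open>w\<close> would have to dominate \<open>p\<close> and
    \<open>q\<close>, as their single out-arcs in \<open>?N\<close> are taken; this contradicts
    \<open>uniq\<close>.\<close>
  have "w = p \<or> w = q \<or> w = r" if "w \<in> ?N" for w
    using tot[OF that p] tot[OF that qr(1)] tot[OF that qr(2)] uniq p qr arcs that asym by metis
  then have N: "?N = {p, q, r}"
    using p qr by blast
  then have c3: "card ?N = 3"
    using three three3 by fastforce
  \<comment> \<open>The same count, excluding only \<open>x\<close> and \<open>y\<close>, gives at
    most 1 + 2.\<close>
  have deg3: "card (nbrs_in V x) = 3" if "x \<in> ?N" "y \<in> ?N" "x \<leadsto> y" for x y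
  proof -
    have c2: "card {x, y} = 2"
      using arc_neq[OF that(3)] by simp
    have "{x, y} \<inter> nbrs_in V x = {}"
      using that asym nloop by (auto simp: nbrs_in_def)
    then have "card (nbrs_in V x) \<le> card (?N - {x, y}) + 2"
      using split outside[OF that] by (meson add_left_mono le_trans)
    moreover have "card (?N - {x, y}) = card ?N - 2"
      using that c2 by (subst card_Diff_subset) auto
    ultimately show ?thesis
      using c3 deg[of x] that(1) NV by auto
  qed
  show thesis
    by (rule that[OF N arcs]) (use deg3 p qr arcs c3 in blast)+
qed

text \<open>The minimum in-degree is three, and by \<open>min_nbrs_in\<close> the in-neighbourhoods
  of \<open>v, p, q, r\<close> are cyclic triangles of vertices of in-degree three. Matching their
  overlaps produces the Paley tournament on \<open>v, p, q, r, x, y, z\<close>.\<close>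

lemma exists_initial_core_three:
  assumes V: "V \<subseteq> U" and v: "v \<in> V" and three: "3 \<le> card (nbrs_in V v)"
    and deg: "\<And>x. x \<in> V \<Longrightarrow> card (nbrs_in V v) \<le> card (nbrs_in V x)"
  shows "\<exists>C. initial_core V C"
proof -
  have "nbrs_in V v \<noteq> {}"
    using three by auto
  then obtain p where "p \<in> nbrs_in V v"
    by blast
  then obtain q r where N: "nbrs_in V v = {p, q, r}" and pqr: "p \<leadsto> q" "q \<leadsto> r" "r \<leadsto> p"
    and c3: "card (nbrs_in V p) = 3" "card (nbrs_in V q) = 3" "card (nbrs_in V r) = 3" "card (nbrs_in V v) = 3"
    using min_nbrs_in[OF V v three deg] by metis
  have deg: "3 \<le> card (nbrs_in V x)" if "x \<in> V" for x
    using deg[OF that] c3 by simp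
  have mem: "x \<in> nbrs_in V y \<longleftrightarrow> x \<in> V \<and> x \<leadsto> y" for x y
    by (simp add: nbrs_in_def)
  have pV: "p \<in> V" "q \<in> V" "r \<in> V" "p \<leadsto> v" "q \<leadsto> v" "r \<leadsto> v"
    using N mem by blast+
  have nb: "\<exists>b c. nbrs_in V x = {a, b, c} \<and> a \<leadsto> b \<and> b \<leadsto> c \<and> c \<leadsto> a \<and>
      card (nbrs_in V a) = 3 \<and> card (nbrs_in V b) = 3 \<and> card (nbrs_in V c) = 3"
    if "x \<in> V" "card (nbrs_in V x) = 3" "a \<in> V" "a \<leadsto> x" for x a
  proof -
    have "a \<in> nbrs_in V x"
      using that mem by blast
    moreover have "3 \<le> card (nbrs_in V x)" "\<And>y. y \<in> V \<Longrightarrow> card (nbrs_in V x) \<le> card (nbrs_in V y)"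
      using that deg by auto
    ultimately show ?thesis
      using min_nbrs_in[OF V that(1)] by metis
  qed
  obtain z y where P: "nbrs_in V p = {r, z, y}" "r \<leadsto> z" "z \<leadsto> y" "y \<leadsto> r"
      "card (nbrs_in V z) = 3" "card (nbrs_in V y) = 3"
    using nb[OF pV(1) c3(1) pV(3) pqr(3)] by blast
  obtain x z' where Q: "nbrs_in V q = {p, x, z'}" "p \<leadsto> x" "x \<leadsto> z'" "z' \<leadsto> p"
      "card (nbrs_in V x) = 3"
    using nb[OF pV(2) c3(2) pV(1) pqr(1)] by blast
  obtain y' x' where R: "nbrs_in V r = {q, y', x'}" "q \<leadsto> y'" "y' \<leadsto> x'" "x' \<leadsto> q"
    using nb[OF pV(3) c3(3) pV(2) pqr(2)] by blast
  have xV: "x \<in> V" "y \<in> V" "z \<in> V" "x' \<in> V" "y' \<in> V" "z' \<in> V"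
    "x \<leadsto> q" "y \<leadsto> p" "z \<leadsto> p" "x' \<leadsto> r" "y' \<leadsto> r" "z' \<leadsto> q"
    using P(1) Q(1) R(1) mem by blast+
  have pn: "p \<noteq> v" "q \<noteq> v" "r \<noteq> v"
    using pV nloop by blast+
  have nv: "x \<noteq> v" "y \<noteq> v" "z \<noteq> v" "x' \<noteq> v" "y' \<noteq> v" "z' \<noteq> v"
    using xV pV asym by blast+
  \<comment> \<open>The last vertex of each of the three triangles also enters another of
    \<open>p, q, r\<close>, hence reappears in that triangle.\<close>
  have "y \<in> {q, y', x'}" "z' \<in> {r, z, y}" "x' \<in> {p, x, z'}"
    using P Q R xV mem by blast+
  moreover have "y \<noteq> q" "z' \<noteq> r" "x' \<noteq> p"
    using xV pqr asym by blast+
  ultimately have cases: "y = y' \<or> y = x'" "z' = z \<or> z' = y" "x' = x \<or> x' = z'"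
    by blast+
  \<comment> \<open>Equality would also force \<open>y = z'\<close>, and \<open>y\<close> would have
    the four in-neighbours \<open>v, z, y', x\<close>.\<close>
  have "y \<noteq> x'"
  proof
    assume yx: "y = x'"
    then have yq: "y \<leadsto> q" "y' \<leadsto> y"
      using R by auto
    then have "y \<in> {p, x, z'}"
      using xV(2) Q(1) mem by auto
    then have yz: "y = z'"
      using xV(8) nloop asym[OF Q(2)] by auto
    have "y \<notin> nbrs_in V v"
      using N asym[OF xV(8)] asym[OF yq(1)] asym[OF P(4)] nloop mem xV(8) yq(1) P(4) by auto
    then have "v \<leadsto> y"
      using total[of v y] V v xV(2) nv(2) mem by auto
    then have sub: "{v, z, y', x} \<subseteq> nbrs_in V y"
      using v xV yz Q(3) P(3) yq by (auto simp: mem)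
    have "v \<noteq> z" "v \<noteq> y'" "v \<noteq> x" "z \<noteq> y'" "z \<noteq> x" "y' \<noteq> x"
      using nv P(2) xV Q(2) R(2) asym by blast+
    then have "card {v, z, y', x} = 4"
      by simp
    moreover have "finite (nbrs_in V y)"
      using P(6) card.infinite by fastforce
    ultimately show False
      using card_mono[OF _ sub] P(6) by simp
  qed
  then have y': "y' = y" and "x' = x \<or> x' = z'"
    using cases by blast+
  moreover have z': "z' = z"
    using cases(2) xV(12) R(2) y' asym by blast
  ultimately have x': "x' = x"
    using xV(10) P(2) asym by blast
  have out: "v \<leadsto> w" if "w \<in> V" "w \<noteq> v" "w \<notin> nbrs_in V v" for w
    using that total[of v w] V v mem by blast
  have ne: "x \<notin> {p, q, r}" "y \<notin> {p, q, r}" "z \<notin> {p, q, r}"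
    using Q(2) xV(7) xV(10) xV(8,9,11,12) R(2) P(2) y' z' x' pqr nloop asym by blast+
  have vx: "v \<leadsto> x" "v \<leadsto> y" "v \<leadsto> z"
    using out xV nv ne N by auto
  have eq3: "A = {a, b, c}" if "card A = 3" "a \<in> A" "b \<in> A" "c \<in> A" "a \<noteq> b" "a \<noteq> c" "b \<noteq> c"
    for A :: "'a set" and a b c
  proof -
    have "finite A"
      using that(1) card.infinite by fastforce
    then show ?thesis
      using card_subset_eq[of A "{a, b, c}"] that by auto
  qed
  have X: "nbrs_in V x = {v, p, y}"
    by (rule eq3) (use Q R y' x' vx xV v pV nv pn ne in \<open>auto simp: mem\<close>)
  have Y: "nbrs_in V y = {v, q, z}"
    by (rule eq3) (use P R y' x' vx xV v pV nv pn ne in \<open>auto simp: mem\<close>)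
  have Z: "nbrs_in V z = {v, r, x}"
    by (rule eq3) (use P Q z' x' vx xV v pV nv pn ne in \<open>auto simp: mem\<close>)
  have xyz: "x \<noteq> y" "y \<noteq> z" "x \<noteq> z"
    using P Q R x' y' z' nloop by auto
  have "card {v, p, q, r, x, y, z} \<le> 7"
    using card_length[of "[v, p, q, r, x, y, z]"] by simp
  moreover have "\<not> pin V v"
    by (rule not_pinI[of x q r]) (use vx xV pV pqr nloop x' in auto)
  moreover have "\<not> pin V p"
    by (rule not_pinI[of v y z]) (use v vx xV pV pqr xyz in auto)
  moreover have "\<not> pin V q"
    by (rule not_pinI[of v x z]) (use v vx xV pV pqr xyz z' in auto)
  moreover have "\<not> pin V r"
    by (rule not_pinI[of v x y]) (use v vx xV pV pqr xyz x' y' in auto)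
  moreover have "\<not> pin V x"
    by (rule not_pinI[of q v y]) (use v vx xV pV nv R y' x' in auto)
  moreover have "\<not> pin V y"
    by (rule not_pinI[of r v z]) (use v vx xV pV nv P in auto)
  moreover have "\<not> pin V z"
    by (rule not_pinI[of p v x]) (use v vx xV pV nv Q z' in auto)
  ultimately show ?thesis
    using N P(1) Q(1) R(1) X Y Z v xV pV pqr x' y' z'
    by (intro exI[of _ "{v, p, q, r, x, y, z}"] initial_coreI[OF V, of _ p q v]) auto
qed

lemma exists_triple_arc_or_initial_core:
  assumes V: "V \<subseteq> U" "V \<noteq> {}" and deg: "\<And>x. x \<in> V \<Longrightarrow> 2 \<le> card (nbrs_in V x)"
  shows "(\<exists>a1 a2 a3 b1 b2 b3. triple_arc V a1 a2 a3 b1 b2 b3) \<or> (\<exists>C. initial_core V C)"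
proof -
  obtain v where v: "v \<in> V" "\<And>x. x \<in> V \<Longrightarrow> card (nbrs_in V v) \<le> card (nbrs_in V x)"
    using V(2) ex_has_least_nat[of "\<lambda>x. x \<in> V" _ "\<lambda>x. card (nbrs_in V x)"] by blast
  then consider "card (nbrs_in V v) = 2" | "3 \<le> card (nbrs_in V v)"
    using deg[of v] by linarith
  then show ?thesis
  proof cases
    case 1
    then show ?thesis
      using exists_triple_arc_or_initial_core_two V(1) v(1) deg by blast
  next
    case 2
    then show ?thesis
      using exists_initial_core_three V(1) v by blast
  qed
qed

section \<open>Structure of triple arcs, studied for one index up to rotation\<close>

lemma triple_arc_rotate: "triple_arc V a1 a2 a3 b1 b2 b3 \<Longrightarrow> triple_arc V a2 a3 a1 b2 b3 b1"
  unfolding triple_arc_def by auto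

lemma triple_arc_dominates:
  assumes "V \<subseteq> U" "triple_arc V a1 a2 a3 b1 b2 b3" "m \<in> V - {a1, a3, b1}"
  shows "a1 \<leadsto> m"
proof -
  have "a1 \<in> V" "m \<notin> nbrs_in V a1"
    using assms unfolding triple_arc_def by auto
  then show ?thesis
    using total[of a1 m] assms(1,3) by (auto simp: nbrs_in_def)
qed

lemma triple_arcD:
  assumes "triple_arc V a1 a2 a3 b1 b2 b3"
  shows "a1 \<in> V" "b1 \<in> V" "a3 \<leadsto> a1" "b1 \<leadsto> a1"
proof -
  have "a3 \<in> nbrs_in V a1" "b1 \<in> nbrs_in V a1"
    using assms unfolding triple_arc_def by simp_all
  then show "a1 \<in> V" "b1 \<in> V" "a3 \<leadsto> a1" "b1 \<leadsto> a1"
    using assms unfolding triple_arc_def nbrs_in_def by auto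
qed

lemma triple_arc_distinct: "triple_arc V a1 a2 a3 b1 b2 b3 \<Longrightarrow> distinct [a1, a2, a3, b1, b2, b3]"
  unfolding triple_arc_def by blast

text \<open>Otherwise \<open>a1\<close> -> \<open>{a2, b3}\<close> -> \<open>{a3, b1}\<close> ->
  \<open>a1\<close> is forbidden. By rotation the \<open>b\<close>s form a cyclic triangle running
  opposite to that of the \<open>a\<close>s.\<close>

lemma triple_arc_reversed:
  assumes V: "V \<subseteq> U" and h: "triple_arc V a1 a2 a3 b1 b2 b3"
  shows "b1 \<leadsto> b3"
proof (rule ccontr)
  note h2 = triple_arc_rotate[OF h] and h3 = triple_arc_rotate[OF triple_arc_rotate[OF h]]
  note d = triple_arcD[OF h] triple_arcD[OF h2] triple_arcD[OF h3] and dist = triple_arc_distinct[OF h]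
  assume "\<not> b1 \<leadsto> b3"
  then have "b3 \<leadsto> b1"
    using total[of b1 b3] d V dist by auto
  moreover have "a1 \<leadsto> b3" "a2 \<leadsto> b1"
    using triple_arc_dominates[OF V h] triple_arc_dominates[OF V h2] d dist by auto
  ultimately show False
    using no_delta[of a1 a2 b3 a3 b1] d V dist by auto
qed

text \<open>Otherwise \<open>b1\<close> -> \<open>{a1, b3}\<close> -> \<open>{b2, m}\<close> ->
  \<open>b1\<close> is forbidden. Going once around the rotations turns the implication into an
  equivalence.\<close>

lemma triple_arc_uniform:
  assumes V: "V \<subseteq> U" and h: "triple_arc V a1 a2 a3 b1 b2 b3"
    and m: "m \<in> V - {a1, a2, a3, b1, b2, b3}" "m \<leadsto> b1"
  shows "m \<leadsto> b3"
proof (rule ccontr)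
  note h2 = triple_arc_rotate[OF h] and h3 = triple_arc_rotate[OF triple_arc_rotate[OF h]]
  note d = triple_arcD[OF h] triple_arcD[OF h2] triple_arcD[OF h3] and dist = triple_arc_distinct[OF h]
  note rev = triple_arc_reversed[OF V h] triple_arc_reversed[OF V h2] triple_arc_reversed[OF V h3]
  assume "\<not> m \<leadsto> b3"
  then have "b3 \<leadsto> m"
    using total[of m b3] d V m by auto
  moreover have "a1 \<leadsto> b2" "a1 \<leadsto> m"
    using triple_arc_dominates[OF V h] d m dist by auto
  ultimately show False
    using no_delta[of b1 a1 b3 b2 m] d rev V m dist by auto
qed

text \<open>The arcs \<open>a1\<close> -> \<open>a2\<close> and \<open>b1\<close> ->
  \<open>b3\<close> each lie in two cyclic triangles. Hence deleting a triple arc removes no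
  pin.\<close>

lemma triple_arc_not_pin:
  assumes V: "V \<subseteq> U" and h: "triple_arc V a1 a2 a3 b1 b2 b3"
  shows "\<not> pin V a1" "\<not> pin V b1"
proof -
  note h2 = triple_arc_rotate[OF h] and h3 = triple_arc_rotate[OF triple_arc_rotate[OF h]]
  note d = triple_arcD[OF h] triple_arcD[OF h2] triple_arcD[OF h3] and dist = triple_arc_distinct[OF h]
  note rev = triple_arc_reversed[OF V h] triple_arc_reversed[OF V h2] triple_arc_reversed[OF V h3]
  have "a2 \<leadsto> b1" "a3 \<leadsto> b1"
    using triple_arc_dominates[OF V h2] triple_arc_dominates[OF V h3] d dist by auto
  then show "\<not> pin V a1" "\<not> pin V b1"
    using d dist rev not_pinI[of a2 a3 b1 V a1] not_pinI[of b3 b2 a3 V b1] by auto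
qed

section \<open>Turning a triple arc into a new pin\<close>

lemma pin_insert:
  assumes "pin V b"
  shows "pin (insert b V) b"
  unfolding pin_def
proof (intro conjI ballI impI; elim conjE)
  fix y z z'
  assume "y \<in> insert b V" "z \<in> insert b V" "z' \<in> insert b V"
    and arcs: "b \<leadsto> y" "y \<leadsto> z" "y \<leadsto> z'" "z \<leadsto> b" "z' \<leadsto> b"
  then have "{y, z, z'} \<subseteq> V"
    using nloop by auto
  then show "z = z'"
    using pinD1[OF assms] arcs by blast
next
  fix y y' z
  assume "y \<in> insert b V" "y' \<in> insert b V" "z \<in> insert b V"
    and arcs: "b \<leadsto> y" "b \<leadsto> y'" "y \<leadsto> z" "y' \<leadsto> z" "z \<leadsto> b"
  then have "{y, y', z} \<subseteq> V"
    using nloop by auto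
  then show "y = y'"
    using pinD2[OF assms] arcs by blast
qed

text \<open>Outside the triple arc, \<open>b1\<close> is a twin of \<open>b3\<close>. Two cyclic
  triangles on an arc at \<open>b3\<close> would, together with this twin, form a forbidden
  configuration in \<open>V\<close>.\<close>

lemma triple_arc_pins:
  assumes V: "V \<subseteq> U" and h: "triple_arc V a1 a2 a3 b1 b2 b3" and K: "pins V K"
  shows "pins (V - {a1, a2, a3, b1, b2}) (insert b3 K)"
proof -
  note h2 = triple_arc_rotate[OF h] and h3 = triple_arc_rotate[OF triple_arc_rotate[OF h]]
  note d = triple_arcD[OF h] triple_arcD[OF h2] triple_arcD[OF h3] and dist = triple_arc_distinct[OF h]
  let ?M = "V - {a1, a2, a3, b1, b2, b3}"
  have KM: "K \<subseteq> ?M"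
    using K triple_arc_not_pin[OF V h] triple_arc_not_pin[OF V h2] triple_arc_not_pin[OF V h3] unfolding pins_def by blast
  have in_iff: "m \<leadsto> b1 \<longleftrightarrow> m \<leadsto> b3" if "m \<in> ?M" for m
    using triple_arc_uniform[OF V h, of m] triple_arc_uniform[OF V h2, of m] triple_arc_uniform[OF V h3, of m] that by blast
  have out_iff: "b1 \<leadsto> m \<longleftrightarrow> b3 \<leadsto> m" if "m \<in> ?M" for m
    using in_iff[OF that] total[of m b1] total[of m b3] asym[of m] asym[of _ m] that d V by auto
  have pin: "pin ?M b3"
    unfolding pin_def
  proof (intro conjI ballI impI; elim conjE)
    fix y z z' assume "y \<in> ?M" "z \<in> ?M" "z' \<in> ?M" "b3 \<leadsto> y" "y \<leadsto> z" "y \<leadsto> z'" "z \<leadsto> b3" "z' \<leadsto> b3"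
    then show "z = z'"
      using no_delta[of y z z' b1 b3] in_iff out_iff d V dist by auto
  next
    fix y y' z assume "y \<in> ?M" "y' \<in> ?M" "z \<in> ?M" "b3 \<leadsto> y" "b3 \<leadsto> y'" "y \<leadsto> z" "y' \<leadsto> z" "z \<leadsto> b3"
    then show "y = y'"
      using no_delta[of z b1 b3 y y'] in_iff out_iff d V dist by auto
  qed
  have MV: "V - {a1, a2, a3, b1, b2} = insert b3 ?M"
    using triple_arcD(2)[OF h3] dist by auto
  have pin3: "pin (insert b3 ?M) b3"
    using pin by (rule pin_insert)
  have pinK: "\<forall>b\<in>K. pin (insert b3 ?M) b"
    using K pin_mono[of V] MV unfolding pins_def by blast
  \<comment> \<open>A cyclic triangle through \<open>b\<close>, \<open>b3\<close> and
    \<open>x\<close> has a copy with \<open>b1\<close> for \<open>b3\<close>; the arc between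
    \<open>b\<close> and \<open>x\<close> lies in both, although \<open>b\<close> is a pin of
    \<open>V\<close>.\<close>
  have no3: "\<not> (b \<leadsto> b3 \<and> b3 \<leadsto> x \<and> x \<leadsto> b)" "\<not> (b3 \<leadsto> b \<and> b \<leadsto> x \<and> x \<leadsto> b3)"
    if "b \<in> K" "x \<in> ?M" for b x
  proof -
    have "pin V b" "b \<in> ?M"
      using K KM that unfolding pins_def by blast+
    then show "\<not> (b \<leadsto> b3 \<and> b3 \<leadsto> x \<and> x \<leadsto> b)" "\<not> (b3 \<leadsto> b \<and> b \<leadsto> x \<and> x \<leadsto> b3)"
      using pinD2[of V b b1 b3 x] pinD1[of V b x b1 b3] in_iff out_iff that d dist by auto
  qed
  have noK: "\<not> (b \<leadsto> c \<and> c \<leadsto> x \<and> x \<leadsto> b)" if "b \<in> K" "c \<in> K" "x \<in> V" for b c x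
    using K that unfolding pins_def by blast
  have b3: "b3 \<in> V"
    using triple_arcD(2)[OF h3] .
  have "\<not> (b \<leadsto> c \<and> c \<leadsto> x \<and> x \<leadsto> b)"
    if "b \<in> insert b3 K" "c \<in> insert b3 K" "x \<in> insert b3 ?M" for b c x
    using that no3(1)[of b x] no3(2)[of c x] noK[of b c x] asym[of b c] nloop b3 by auto
  then show ?thesis
    unfolding MV pins_def using pin3 pinK KM by blast
qed

section \<open>The induction on vertex sets with pins\<close>

text \<open>
  Of a triple arc only \<open>b3\<close> is kept, and \<open>a1\<close> and \<open>a2\<close> are added to the solution for the rest. A gain
  of two for five removed vertices is short of $3/7$ by one seventh, which is recovered from the
  summand \<open>card K\<close> by making \<open>b3\<close> a pin.
\<close>

lemma pinned_acyclic:
  "V \<subseteq> U \<Longrightarrow> pins V K \<Longrightarrow> \<exists>W. K \<subseteq> W \<and> W \<subseteq> V \<and> acyclic_on W \<and> 3 * card V + card K \<le> 7 * card W"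
proof (induction "card V" arbitrary: V K rule: less_induct)
  case less
  note V = less.prems(1) and K = less.prems(2)
  have fin: "finite A" if "A \<subseteq> V" for A
    using finite_subset[OF _ finite_U] that V by blast
  have KV: "K \<subseteq> V" and Kpin: "\<And>b. b \<in> K \<Longrightarrow> pin V b"
    and K3: "\<And>b c x. b \<in> K \<Longrightarrow> c \<in> K \<Longrightarrow> x \<in> V \<Longrightarrow> \<not> (b \<leadsto> c \<and> c \<leadsto> x \<and> x \<leadsto> b)"
    using K unfolding pins_def by blast+
  have IH: "\<exists>W. K' \<subseteq> W \<and> W \<subseteq> V - D \<and> acyclic_on W \<and> 3 * (card V - card D) + card K' \<le> 7 * card W"
    if "D \<subseteq> V" "D \<noteq> {}" "pins (V - D) K'" for D K'
  proof -
    have "V - D \<subset> V"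
      using that by blast
    then have "card (V - D) < card V"
      using fin by (intro psubset_card_mono) auto
    moreover have "card (V - D) = card V - card D"
      using that fin by (simp add: card_Diff_subset)
    ultimately show ?thesis
      using less.hyps[of "V - D" K'] that V by auto
  qed
  \<comment> \<open>Gaining one vertex for at most two deleted ones leaves 7 - 6 = 1, enough to pay
    for one lost pin.\<close>
  have small: "card D \<le> 2 \<Longrightarrow> 3 * (card V - card D) + k \<le> 7 * n \<Longrightarrow> 3 * card V + Suc k \<le> 7 * Suc n"
    for D :: "'a set" and k n
    by arith
  show ?case
  proof (cases "\<exists>b\<in>K. \<exists>m. \<forall>y\<in>V. \<forall>z\<in>V. b \<leadsto> y \<and> y \<leadsto> z \<and> z \<leadsto> b \<longrightarrow> y = m \<or> z = m")
    case True
    then obtain b m where b: "b \<in> K"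
      and m: "\<And>y z. y \<in> V \<Longrightarrow> z \<in> V \<Longrightarrow> b \<leadsto> y \<Longrightarrow> y \<leadsto> z \<Longrightarrow> z \<leadsto> b \<Longrightarrow> y = m \<or> z = m"
      by blast
    \<comment> \<open>If \<open>m\<close> is itself a pin it must stay; then no cyclic triangle
      contains both \<open>b\<close> and \<open>m\<close>, by \<open>K3\<close>. Otherwise deleting
      \<open>m\<close> destroys all cyclic triangles through \<open>b\<close>.\<close>
    define D where "D = insert b ({m} \<inter> (V - K))"
    have "pins (V - D) (K - {b})"
      by (rule pins_mono[OF K]) (use KV in \<open>auto simp: D_def\<close>)
    moreover have "D \<subseteq> V" "D \<noteq> {}"
      using b KV by (auto simp: D_def)
    ultimately have "\<exists>W. K - {b} \<subseteq> W \<and> W \<subseteq> V - D \<and> acyclic_on W \<and>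
        3 * (card V - card D) + card (K - {b}) \<le> 7 * card W"
      by (intro IH)
    then obtain W where W: "K - {b} \<subseteq> W" "W \<subseteq> V - D" "acyclic_on W"
      "3 * (card V - card D) + card (K - {b}) \<le> 7 * card W"
      by (elim exE conjE) (rule that)
    have "acyclic_on (insert b W)"
    proof (rule acyclic_on_insert[OF W(3)])
      fix y z assume yz: "y \<in> W" "z \<in> W"
      show "\<not> (b \<leadsto> y \<and> y \<leadsto> z \<and> z \<leadsto> b)"
        using m[of y z] yz W(2) b K3[of b m z] K3[of m b y] unfolding D_def by auto
    qed
    moreover have "card D \<le> 2"
      unfolding D_def using card_insert_le_m1[of 2 "{m} \<inter> (V - K)" b] card_mono[of "{m}" "{m} \<inter> (V - K)"] by auto
    moreover have "card (insert b W) = Suc (card W)"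
      using W(2) fin[of W] by (subst card_insert_disjoint) (auto simp: D_def)
    moreover have "card K = Suc (card (K - {b}))"
      using card_Suc_Diff1[OF fin[OF KV] b] by simp
    ultimately show ?thesis
      using W(1,2) b KV small[OF _ W(4)] by (intro exI[of _ "insert b W"]) auto
  next
    case free: False
    show ?thesis
    proof (cases "\<exists>v\<in>V. card (nbrs_in V v) < 2")
      case True
      then obtain v where v: "v \<in> V" "card (nbrs_in V v) < 2"
        by blast
      have fN: "finite (nbrs_in V v)"
        by (rule fin) (auto simp: nbrs_in_def)
      then have uniq: "u = u'" if "u \<in> nbrs_in V v" "u' \<in> nbrs_in V v" for u u'
        using v(2) that card_le_Suc0_iff_eq[OF fN] by (auto simp: less_2_cases_iff)
      \<comment> \<open>All cyclic triangles through \<open>v\<close> use its only possible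
        in-neighbour, which \<open>free\<close> forbids for a pin.\<close>
      have vK: "v \<notin> K"
      proof
        assume "v \<in> K"
        moreover obtain u where "\<And>z. z \<in> V \<Longrightarrow> z \<leadsto> v \<Longrightarrow> z = u"
          using uniq unfolding nbrs_in_def by blast
        ultimately show False
          using free by blast
      qed
      have out: "v \<leadsto> w" if "w \<in> V" "w \<noteq> v" "w \<notin> nbrs_in V v" for w
        using that total[of v w] v(1) V by (auto simp: nbrs_in_def)
      \<comment> \<open>Each in-neighbour of \<open>u\<close> forms a cyclic triangle on the arc
        \<open>u\<close> -> \<open>v\<close>. If \<open>u\<close> were a pin it would have at most
        one in-neighbour, again contradicting \<open>free\<close>.\<close>
      have NK: "u \<notin> K" if u: "u \<in> nbrs_in V v" for u
      proof
        assume uK: "u \<in> K"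
        have uv: "u \<leadsto> v" "u \<in> V"
          using u by (auto simp: nbrs_in_def)
        have "v \<leadsto> z" if "z \<in> V" "z \<leadsto> u" for z
          using out[OF that(1)] uniq[OF u, of z] that asym[OF uv(1)] nloop by auto
        then have "z = z'" if "z \<in> V" "z \<leadsto> u" "z' \<in> V" "z' \<leadsto> u" for z z'
          using pinD1[OF Kpin[OF uK], of v z z'] that uv v(1) by auto
        then obtain m where "\<And>z. z \<in> V \<Longrightarrow> z \<leadsto> u \<Longrightarrow> z = m"
          by blast
        then show False
          using free uK by blast
      qed
      define D where "D = insert v (nbrs_in V v)"
      have D: "D \<subseteq> V" "D \<noteq> {}"
        using v by (auto simp: D_def nbrs_in_def)
      have KD: "K \<subseteq> V - D"
        using KV vK NK by (auto simp: D_def)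
      then have "pins (V - D) K"
        using pins_mono[OF K] by simp
      from IH[OF D this] obtain W where W: "K \<subseteq> W" "W \<subseteq> V - D" "acyclic_on W"
        "3 * (card V - card D) + card K \<le> 7 * card W"
        by (elim exE conjE) (rule that)
      have "acyclic_on (insert v W)"
        using W(2,3) out by (intro acyclic_on_insert_source) (auto simp: D_def)
      moreover have "card D \<le> 2"
        unfolding D_def using v(2) card_insert_le_m1[of 2 "nbrs_in V v" v] by auto
      moreover have "card (insert v W) = Suc (card W)"
        using W(2) fin[of W] by (subst card_insert_disjoint) (auto simp: D_def)
      ultimately show ?thesis
        using W(1,2) v(1) small[OF _ W(4)] by (intro exI[of _ "insert v W"]) auto
    next
      case False
      then have deg: "2 \<le> card (nbrs_in V x)" if "x \<in> V" for x
        using that by (meson not_less)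
      show ?thesis
      proof (cases "V = {}")
        case True
        then show ?thesis
          using KV by (intro exI[of _ "{}"]) (auto simp: acyclic_on_def)
      next
        case False
        then consider (triple_arc) a1 a2 a3 b1 b2 b3 where "triple_arc V a1 a2 a3 b1 b2 b3" | (initial_core) C where "initial_core V C"
          using exists_triple_arc_or_initial_core[OF V _ deg] by blast
        then show ?thesis
        proof cases
          case triple_arc
          note h = triple_arc and h2 = triple_arc_rotate[OF triple_arc] and h3 = triple_arc_rotate[OF triple_arc_rotate[OF triple_arc]]
          note d = triple_arcD[OF h] triple_arcD[OF h2] triple_arcD[OF h3] and dist = triple_arc_distinct[OF h]
          let ?D = "{a1, a2, a3, b1, b2}"
          have D: "?D \<subseteq> V" "?D \<noteq> {}" "card ?D = 5"
            using d dist by auto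
          from IH[OF D(1,2) triple_arc_pins[OF V h K]] obtain W where W: "insert b3 K \<subseteq> W" "W \<subseteq> V - ?D" "acyclic_on W"
            "3 * (card V - card ?D) + card (insert b3 K) \<le> 7 * card W"
            by (elim exE conjE) (rule that)
          \<comment> \<open>\<open>a2\<close> and then \<open>a1\<close> can go in front, as the
            in-neighbours \<open>a3, b1\<close> of \<open>a1\<close> and \<open>a1, b2\<close> of
            \<open>a2\<close> are all among the deleted vertices.\<close>
          have "acyclic_on (insert a2 W)"
            using W(2) triple_arc_dominates[OF V h2] by (intro acyclic_on_insert_source[OF W(3)]) auto
          moreover have "a1 \<leadsto> w" if "w \<in> insert a2 W" for w
            using that d W(2) triple_arc_dominates[OF V h] by auto
          ultimately have "acyclic_on (insert a1 (insert a2 W))"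
            by (rule acyclic_on_insert_source)
          moreover have "card (insert a1 (insert a2 W)) = card W + 2"
            using W(2) dist fin[of W] by (subst card_insert_disjoint; auto)+
          moreover have "b3 \<notin> K"
            using Kpin triple_arc_not_pin(2)[OF V h3] by blast
          then have "card (insert b3 K) = Suc (card K)"
            using fin[OF KV] by simp
          ultimately show ?thesis
            using W D d by (intro exI[of _ "insert a1 (insert a2 W)"]) auto
        next
          case initial_core
          then obtain p q v where C: "C \<subseteq> V" "card C \<le> 7" "\<And>c u. c \<in> C \<Longrightarrow> u \<in> V - C \<Longrightarrow> c \<leadsto> u"
            "\<And>c. c \<in> C \<Longrightarrow> \<not> pin V c" and pqv: "p \<in> C" "q \<in> C" "v \<in> C" "p \<leadsto> q" "p \<leadsto> v" "q \<leadsto> v"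
            unfolding initial_core_def by blast
          have KC: "K \<subseteq> V - C"
            using KV Kpin C(4) by blast
          then have "pins (V - C) K"
            using pins_mono[OF K] by simp
          moreover have "C \<noteq> {}"
            using pqv(1) by blast
          ultimately have "\<exists>W. K \<subseteq> W \<and> W \<subseteq> V - C \<and> acyclic_on W \<and>
              3 * (card V - card C) + card K \<le> 7 * card W"
            by (intro IH[OF C(1)])
          then obtain W where W: "K \<subseteq> W" "W \<subseteq> V - C" "acyclic_on W"
            "3 * (card V - card C) + card K \<le> 7 * card W"
            by (elim exE conjE) (rule that)
          have out: "c \<leadsto> w" if "c \<in> C" "w \<in> W" for c w
            using C(3) that W(2) by blast
          have "acyclic_on (insert v W)"
            using out pqv(3) by (intro acyclic_on_insert_source[OF W(3)]) auto
          then have "acyclic_on (insert q (insert v W))"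
            by (rule acyclic_on_insert_source) (use out pqv in auto)
          then have "acyclic_on (insert p (insert q (insert v W)))"
            by (rule acyclic_on_insert_source) (use out pqv in auto)
          moreover have "card (insert p (insert q (insert v W))) = card W + 3"
          proof -
            have "p \<notin> insert q (insert v W)" "q \<notin> insert v W" "v \<notin> W"
              using pqv W(2) nloop by auto
            then show ?thesis
              using finite_subset[OF W(2) fin[OF Diff_subset]] by simp
          qed
          ultimately show ?thesis
            using W C(1,2) pqv by (intro exI[of _ "insert p (insert q (insert v W))"]) auto
        qed
      qed
    qed
  qed
qed

lemma acyclic_subset:
  obtains W where "W \<subseteq> U" "acyclic_on W" "3 * card U \<le> 7 * card W"
  using pinned_acyclic[of U "{}"] by (auto simp: pins_def)

end

subsection \<open>Digraphs\<close>

lemma dominates_induce_subgraph_iff: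
  "u \<rightarrow>\<^bsub>G \<restriction> W\<^esub> v \<longleftrightarrow> u \<in> W \<and> v \<in> W \<and> u \<rightarrow>\<^bsub>G\<^esub> v"
  by (auto simp: arcs_ends_conv)

text \<open>The ten arcs cover all pairs of the five vertices, so they force distinctness and
  determine the induced subtournament completely.\<close>

lemma (in tournament) Delta122_free_arcs:
  assumes free: "free_of Delta122 G"
    and arcs: "x \<rightarrow> y" "x \<rightarrow> y'" "y \<rightarrow> y'" "y \<rightarrow> z" "y \<rightarrow> z'" "y' \<rightarrow> z" "y' \<rightarrow> z'" "z \<rightarrow> z'" "z \<rightarrow> x" "z' \<rightarrow> x"
  shows False
proof -
  let ?S = "{x, y, y', z, z'}"
  \<comment> \<open>The default value \<open>X\<close> serves as the image of
    \<open>x\<close>.\<close>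
  define g where "g = (\<lambda>v. X)(y := Y1, y' := Y2, z := Z1, z' := Z2)"
  let ?H = "G \<restriction> ?S"
  \<comment> \<open>Arcs of \<open>Delta122\<close> are pairs of vertices, so an arc is sent to the
    pair of images of its ends; this is injective as there are no parallel arcs.\<close>
  let ?f = "\<lparr>iso_verts = g, iso_arcs = (\<lambda>e. (g (tail G e), g (head G e))), iso_head = snd, iso_tail = fst\<rparr>"
  have S: "?S \<subseteq> verts G"
    using arcs by auto
  have neq: "u \<noteq> v" if "u \<rightarrow> v" for u v
    using that adj_not_same by blast
  have asym: "\<not> v \<rightarrow> u" if "u \<rightarrow> v" for u v
    using that one_direction[of u v] neq[of u v] by auto
  note dist = arcs[THEN neq]
  have ends: "arcs_ends ?H = {(x, y), (x, y'), (y, y'), (y, z), (y, z'), (y', z), (y', z'), (z, z'), (z, x), (z', x)}"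
    (is "_ = ?E")
  proof
    show "arcs_ends ?H \<subseteq> ?E"
    proof (rule subrelI)
      fix u v
      assume "u \<rightarrow>\<^bsub>?H\<^esub> v"
      then have uv: "u \<rightarrow> v" "u \<in> ?S" "v \<in> ?S"
        unfolding dominates_induce_subgraph_iff by blast+
      then show "(u, v) \<in> ?E"
        using arcs[THEN asym] neq[OF uv(1)] by auto
    qed
    show "?E \<subseteq> arcs_ends ?H"
      using arcs by (simp add: dominates_induce_subgraph_iff)
  qed
  have g: "g x = X" "g y = Y1" "g y' = Y2" "g z = Z1" "g z' = Z2"
    using dist by (auto simp: g_def)
  then have inj: "inj_on g ?S"
    by (auto simp: inj_on_def)
  have "inj_on (\<lambda>e. (g (tail G e), g (head G e))) (arcs ?H)"
  proof (rule inj_onI)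
    fix e e'
    assume e: "e \<in> arcs ?H" "e' \<in> arcs ?H"
      and eq: "(g (tail G e), g (head G e)) = (g (tail G e'), g (head G e'))"
    have "tail G e = tail G e'"
      by (rule inj_onD[OF inj]) (use e eq in simp_all)
    moreover have "head G e = head G e'"
      by (rule inj_onD[OF inj]) (use e eq in simp_all)
    ultimately show "e = e'"
      using no_multi_arcs[of e e'] e by (simp add: arc_to_ends_def)
  qed
  then have "pre_digraph.digraph_isomorphism ?H ?f"
    unfolding pre_digraph.digraph_isomorphism_def using inj wellformed_induce_subgraph by simp
  moreover have "iso_arcs ?f ` arcs ?H = (\<lambda>(u, v). (g u, g v)) ` arcs_ends ?H"
    unfolding arcs_ends_conv image_image by simp
  then have "iso_arcs ?f ` arcs ?H = arcs Delta122"
    unfolding ends by (simp add: g Delta122_def) blast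
  then have "Delta122 = app_iso ?f ?H"
    by (intro pre_digraph.equality) (simp_all add: g Delta122_def)
  ultimately have "digraph_iso ?H Delta122"
    unfolding digraph_iso_def by blast
  then show False
    using free induced_induce[OF S] unfolding free_of_def by blast
qed

text \<open>For a path \<open>x\<close> -> \<open>y\<close> -> \<open>z\<close> in \<open>W\<close>,
  the arc between \<open>x\<close> and \<open>z\<close> must leave \<open>x\<close>, since otherwise
  a cyclic triangle closes.\<close>

lemma transitive_tournament_induce:
  assumes "tournament T" "W \<subseteq> verts T"
    and acyc: "\<And>x y z. x \<in> W \<Longrightarrow> y \<in> W \<Longrightarrow> z \<in> W \<Longrightarrow> x \<rightarrow>\<^bsub>T\<^esub> y \<Longrightarrow> y \<rightarrow>\<^bsub>T\<^esub> z \<Longrightarrow> \<not> z \<rightarrow>\<^bsub>T\<^esub> x"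
  shows "transitive_tournament (T \<restriction> W)"
proof -
  interpret tournament T by fact
  note dom = dominates_induce_subgraph_iff
  interpret H: wf_digraph "T \<restriction> W" ..
  have "tournament (T \<restriction> W)"
  proof unfold_locales
    show "finite (verts (T \<restriction> W))" "finite (arcs (T \<restriction> W))"
      using finite_subset[OF assms(2) finite_verts] by simp_all
    show "tail (T \<restriction> W) e \<noteq> head (T \<restriction> W) e" if "e \<in> arcs (T \<restriction> W)" for e
      using that no_loops by simp
    show "e = e'" if "e \<in> arcs (T \<restriction> W)" "e' \<in> arcs (T \<restriction> W)"
      "arc_to_ends (T \<restriction> W) e = arc_to_ends (T \<restriction> W) e'" for e e'
      using that no_multi_arcs by simp
    show "u \<rightarrow>\<^bsub>T \<restriction> W\<^esub> v \<longleftrightarrow> \<not> v \<rightarrow>\<^bsub>T \<restriction> W\<^esub> u"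
      if "u \<in> verts (T \<restriction> W)" "v \<in> verts (T \<restriction> W)" "u \<noteq> v" for u v
      using that one_direction[of u v] assms(2) by (auto simp: dom)
  qed
  moreover have "trans (arcs_ends (T \<restriction> W))"
  proof (rule transI)
    fix x y z
    assume "x \<rightarrow>\<^bsub>T \<restriction> W\<^esub> y" "y \<rightarrow>\<^bsub>T \<restriction> W\<^esub> z"
    then have xyz: "x \<in> W" "y \<in> W" "z \<in> W" "x \<rightarrow>\<^bsub>T\<^esub> y" "y \<rightarrow>\<^bsub>T\<^esub> z"
      by (auto simp: dom)
    then have "x \<noteq> z"
      using one_direction[of x y] adj_not_same assms(2) by blast
    then show "x \<rightarrow>\<^bsub>T \<restriction> W\<^esub> z"
      using xyz acyc[of x y z] one_direction[of x z] assms(2) by (auto simp: dom)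
  qed
  ultimately show ?thesis
    unfolding transitive_tournament_def by blast
qed

theorem theorem1p4:
  fixes T :: "('a, 'b) pre_digraph" and n :: nat
  assumes "tournament T"
    and "free_of Delta122 T"
    and "card (verts T) = n"
  shows "real (trans_number T) \<ge> 3 * real n / 7"
proof -
  interpret tournament T by fact
  interpret delta122_free "verts T" "\<lambda>u v. u \<rightarrow>\<^bsub>T\<^esub> v"
  proof
    show "finite (verts T)"
      by simp
    show "\<not> v \<rightarrow>\<^bsub>T\<^esub> u" if "u \<rightarrow>\<^bsub>T\<^esub> v" for u v
      using that one_direction adj_in_verts adj_not_same by metis
    show tot: "u \<rightarrow>\<^bsub>T\<^esub> v \<or> v \<rightarrow>\<^bsub>T\<^esub> u" if "u \<in> verts T" "v \<in> verts T" "u \<noteq> v" for u v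
      using that one_direction[of u v] by auto
    fix x y y' z z'
    assume "y \<in> verts T" "y' \<in> verts T" "z \<in> verts T" "z' \<in> verts T" "y \<noteq> y'" "z \<noteq> z'"
    then have "y \<rightarrow>\<^bsub>T\<^esub> y' \<or> y' \<rightarrow>\<^bsub>T\<^esub> y" "z \<rightarrow>\<^bsub>T\<^esub> z' \<or> z' \<rightarrow>\<^bsub>T\<^esub> z"
      using tot by blast+
    moreover assume "x \<rightarrow>\<^bsub>T\<^esub> y" "x \<rightarrow>\<^bsub>T\<^esub> y'" "y \<rightarrow>\<^bsub>T\<^esub> z" "y \<rightarrow>\<^bsub>T\<^esub> z'" "y' \<rightarrow>\<^bsub>T\<^esub> z" "y' \<rightarrow>\<^bsub>T\<^esub> z'"
      "z \<rightarrow>\<^bsub>T\<^esub> x" "z' \<rightarrow>\<^bsub>T\<^esub> x"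
    ultimately show False
      \<comment> \<open>One instance for each choice of orientations inside the two pairs.\<close>
      using Delta122_free_arcs[OF assms(2), of x y y' z z'] Delta122_free_arcs[OF assms(2), of x y' y z z']
        Delta122_free_arcs[OF assms(2), of x y y' z' z] Delta122_free_arcs[OF assms(2), of x y' y z' z]
      by blast
  qed
  obtain W where W: "W \<subseteq> verts T" "acyclic_on W" "3 * card (verts T) \<le> 7 * card W"
    by (rule acyclic_subset)
  have "transitive_tournament (T \<restriction> W)"
  proof (rule transitive_tournament_induce[OF assms(1) W(1)])
    show "\<not> z \<rightarrow>\<^bsub>T\<^esub> x" if "x \<in> W" "y \<in> W" "z \<in> W" "x \<rightarrow>\<^bsub>T\<^esub> y" "y \<rightarrow>\<^bsub>T\<^esub> z" for x y z
      using W(2) that unfolding acyclic_on_def by blast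
  qed
  moreover have "subgraph (T \<restriction> W) T"
    using induced_induce[OF W(1)] by (simp add: induced_subgraph_def)
  ultimately have "card W \<le> trans_number T"
    using trans_number_attained(2)[OF assms(1), of "T \<restriction> W"] by simp
  then show ?thesis
    using W(3) assms(3) by simp
qed

end
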